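(* Let $n\ge 1$ and let $a$ be an integer with $a\not\equiv 0 \pmod{p_i}$ for all $1\le i\le n$. Then there are exactly $$\prod_{3\le i\le n}(p_i-2) = (p_3-2)(p_4-2)\cdots(p_n-2)$$ integers $x$ in $P_n$ such that $x-a$ and $x+a$ (taken modulo $\prod_{1\le i\le n}p_i$) are both $n$-primes.
   Context: $p_i$ denotes the $i$-th prime number ($p_1=2$, $p_2=3$, $p_3=5,\dots$). An integer is called an $n$-prime if it is not divisible by any of the first $n$ primes $p_1,\dots,p_n$. $P_n=\{x\in\mathbb{Z} : 0\le x<\prod_{1\le i\le n}p_i\}$. An empty product equals $1$. *)

theory Defs
  imports "HOL-Library.Infinite_Set" "HOL-Number_Theory.Cong"
    "HOL-Computational_Algebra.Primes"
begin

(* enumerate counts from 0, while the primes are indexed from 1; only i >= 1 is meaningful. *)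
definition nth_prime :: "nat \<Rightarrow> nat" where
  "nth_prime i = enumerate {p. prime p} (i - 1)"

definition primorial :: "nat \<Rightarrow> int" where
  "primorial n = (\<Prod>i=1..n. int (nth_prime i))"

definition n_prime :: "nat \<Rightarrow> int \<Rightarrow> bool" where
  "n_prime n x \<longleftrightarrow> (\<forall>i\<in>{1..n}. \<not> int (nth_prime i) dvd x)"

definition P :: "nat \<Rightarrow> int set" where
  "P n = {x. 0 \<le> x \<and> x < primorial n}"

end

theory Submission
  imports Defs
begin

text \<open>By the Chinese remainder theorem the count is the product over i of the number of residues r
modulo p_i with r different from a and -a. These two excluded residues coincide exactly when
p_i = 2, so the local factor is p_i - 2 for odd p_i and 1 for p_1 = 2; the factor p_2 - 2 of
the prime 3 is also 1, which leaves the product over i at least 3.\<close>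

text \<open>Chinese remainder theorem as a bijection: coprimality makes a number unique modulo
  \<open>m * k\<close>, which gives injectivity. For surjectivity, a solution of the two congruences
  is reduced modulo \<open>m * k\<close> to land in the interval.\<close>

lemma bij_betw_mod_int:
  fixes m k :: int
  assumes "m > 0" "k > 0" "coprime m k"
  shows "bij_betw (\<lambda>x. (x mod m, x mod k)) {0..<m * k} ({0..<m} \<times> {0..<k})"
  unfolding bij_betw_def
proof (intro conjI set_eqI iffI)
  show "inj_on (\<lambda>x. (x mod m, x mod k)) {0..<m * k}"
  proof (rule inj_onI)
    fix x y assume xy: "x \<in> {0..<m * k}" "y \<in> {0..<m * k}"
      and "(x mod m, x mod k) = (y mod m, y mod k)"
    then have "[x = y] (mod m)" "[x = y] (mod k)"
      by (simp_all add: cong_def)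
    then have "[x = y] (mod m * k)"
      using assms(3) by (rule coprime_cong_mult)
    then show "x = y"
      using xy by (simp add: cong_def)
  qed
next
  fix z assume "z \<in> (\<lambda>x. (x mod m, x mod k)) ` {0..<m * k}"
  then show "z \<in> {0..<m} \<times> {0..<k}"
    using assms by auto
next
  fix z assume z: "z \<in> {0..<m} \<times> {0..<k}"
  obtain x where x: "[x = fst z] (mod m)" "[x = snd z] (mod k)"
    using binary_chinese_remainder_int[OF assms(3)] by blast
  have "x mod (m * k) \<in> {0..<m * k}"
    using assms by simp
  moreover have "x mod (m * k) mod m = fst z" "x mod (m * k) mod k = snd z"
    using x z by (auto simp: mod_mod_cancel cong_def)
  ultimately show "z \<in> (\<lambda>x. (x mod m, x mod k)) ` {0..<m * k}"
    by (intro image_eqI[of _ _ "x mod (m * k)"]) auto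
qed

text \<open>The bijection above carries the set being counted onto a rectangle, so its cardinality
  factors.\<close>

lemma card_residue_conditions:
  fixes m k :: int
  assumes "m > 0" "k > 0" "coprime m k"
  shows "card {x \<in> {0..<m * k}. A (x mod m) \<and> B (x mod k)}
           = card {r \<in> {0..<m}. A r} * card {r \<in> {0..<k}. B r}"
proof -
  define f where "f x = (x mod m, x mod k)" for x
  define X where "X = {x \<in> {0..<m * k}. A (x mod m) \<and> B (x mod k)}"
  have f: "inj_on f {0..<m * k}" "f ` {0..<m * k} = {0..<m} \<times> {0..<k}"
    using bij_betw_mod_int[OF assms] by (simp_all only: bij_betw_def f_def[abs_def])
  \<comment> \<open>Within the interval, membership in \<open>X\<close> depends only on
    \<open>f x\<close>, so the restriction can be moved past the image.\<close>
  have "f ` X = f ` {0..<m * k} \<inter> Collect A \<times> Collect B"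
    unfolding X_def f_def by blast
  then have "f ` X = {r \<in> {0..<m}. A r} \<times> {r \<in> {0..<k}. B r}"
    unfolding f(2) by auto
  moreover have "card (f ` X) = card X"
    by (intro card_image inj_on_subset[OF f(1)]) (auto simp: X_def)
  ultimately show ?thesis
    by (simp only: card_cartesian_product flip: X_def)
qed

text \<open>Induction on \<open>I\<close>, splitting off one modulus: it is coprime to the product
  of the others, so the count for two moduli applies.\<close>

lemma card_residue_conditions_prod:
  fixes m :: "'i \<Rightarrow> int"
  assumes "finite I" "\<And>i. i \<in> I \<Longrightarrow> m i > 0"
    and "\<And>i j. i \<in> I \<Longrightarrow> j \<in> I \<Longrightarrow> i \<noteq> j \<Longrightarrow> coprime (m i) (m j)"
  shows "card {x \<in> {0..<prod m I}. \<forall>i\<in>I. R i (x mod m i)}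
           = (\<Prod>i\<in>I. card {r \<in> {0..<m i}. R i r})"
  using assms
proof (induction I rule: finite_induct)
  case empty
  have "{0..<1::int} = {0}" by auto
  then show ?case by simp
next
  case (insert j I)
  \<comment> \<open>As \<open>m i\<close> divides \<open>prod m I\<close>, the conditions for
    \<open>i\<close> in \<open>I\<close> depend only on the residue modulo \<open>prod m I\<close>,
    the form required for the second modulus.\<close>
  have "x mod prod m I mod m i = x mod m i" if "i \<in> I" for x i
    using that insert.hyps by (simp add: dvd_prodI mod_mod_cancel)
  then have "{x \<in> {0..<prod m (insert j I)}. \<forall>i\<in>insert j I. R i (x mod m i)}
      = {x \<in> {0..<m j * prod m I}. R j (x mod m j) \<and> (\<forall>i\<in>I. R i (x mod prod m I mod m i))}"
    using insert.hyps by auto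
  moreover have "coprime (m j) (prod m I)"
    using insert.hyps insert.prems(2) by (intro prod_coprime_right) auto
  moreover have "prod m I > 0"
    using insert.prems(1) by (intro prod_pos) auto
  ultimately have "card {x \<in> {0..<prod m (insert j I)}. \<forall>i\<in>insert j I. R i (x mod m i)}
      = card {r \<in> {0..<m j}. R j r} * card {x \<in> {0..<prod m I}. \<forall>i\<in>I. R i (x mod m i)}"
    using card_residue_conditions[of "m j" "prod m I" "R j" "\<lambda>y. \<forall>i\<in>I. R i (y mod m i)"]
      insert.prems(1) by simp
  then show ?case
    using insert by simp
qed

text \<open>The excluded residues are \<open>a mod p\<close> and \<open>(- a) mod p\<close>, which
  coincide exactly when \<open>p\<close> divides their difference \<open>2 * a\<close>. The case
  split treats the prime 2 and the odd primes together.\<close>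

lemma card_residues_avoiding:
  fixes p a :: int
  assumes "p > 0"
  shows "int (card {r \<in> {0..<p}. \<not> p dvd r - a \<and> \<not> p dvd r + a})
           = (if p dvd 2 * a then p - 1 else p - 2)"
proof -
  have "r = a mod p \<longleftrightarrow> p dvd r - a" "r = (- a) mod p \<longleftrightarrow> p dvd r + a" if "r \<in> {0..<p}" for r
    using that mod_eq_dvd_iff[of r p a] mod_eq_dvd_iff[of r p "- a"]
    by (simp_all only: mod_pos_pos_trivial atLeastLessThan_iff diff_minus_eq_add)
  then have "{r \<in> {0..<p}. \<not> p dvd r - a \<and> \<not> p dvd r + a} = {0..<p} - {a mod p, (- a) mod p}"
    by (intro set_eqI) (simp only: mem_Collect_eq Diff_iff insert_iff empty_iff simp_thms de_Morgan_disj cong: conj_cong)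
  moreover have sub: "{a mod p, (- a) mod p} \<subseteq> {0..<p}"
    using assms by simp
  have "int (card ({0..<p} - {a mod p, (- a) mod p})) = p - int (card {a mod p, (- a) mod p})"
    using card_Diff_subset[OF _ sub] card_mono[OF _ sub] assms by (simp add: of_nat_diff)
  moreover have "a mod p = (- a) mod p \<longleftrightarrow> p dvd 2 * a"
    by (simp only: mod_eq_dvd_iff diff_minus_eq_add mult_2)
  then have "int (card {a mod p, (- a) mod p}) = (if p dvd 2 * a then 1 else 2)"
    by (cases "p dvd 2 * a") simp_all
  ultimately show ?thesis
    by simp
qed

lemma prime_nth_prime: "prime (nth_prime i)"
  using enumerate_in_set[OF primes_infinite] by (auto simp: nth_prime_def)

text \<open>Index 0 has to be excluded: by truncated subtraction \<open>nth_prime 0\<close> equals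
  \<open>nth_prime 1\<close>.\<close>

lemma nth_prime_inj:
  assumes "nth_prime i = nth_prime j" "1 \<le> i" "1 \<le> j"
  shows "i = j"
proof -
  have "i - 1 = j - 1"
    using strict_mono_enumerate[OF primes_infinite] assms(1)
    by (simp add: nth_prime_def strict_mono_eq)
  then show ?thesis
    using assms by simp
qed

lemma nth_prime_1: "nth_prime 1 = 2"
  unfolding nth_prime_def
  by (auto simp: enumerate_0 intro!: Least_equality prime_ge_2_nat)

lemma nth_prime_2: "nth_prime 2 = 3"
proof -
  have "enumerate {p::nat. prime p} 1 = (LEAST q. q \<in> {p. prime p} \<and> enumerate {p. prime p} 0 < q)"
    using enumerate_Suc''[OF primes_infinite, of 0] by simp
  also have "\<dots> = 3"
    using nth_prime_1 by (intro Least_equality) (auto simp: nth_prime_def)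
  finally show ?thesis
    by (simp add: nth_prime_def)
qed

lemma nth_prime_dvd_primorial:
  "i \<in> {1..n} \<Longrightarrow> int (nth_prime i) dvd primorial n"
  unfolding primorial_def by (rule dvd_prodI) auto

text \<open>Each of the first \<open>n\<close> primes divides the modulus, so reduction preserves
  divisibility by it. This removes the outer reductions from the theorem.\<close>

lemma n_prime_mod_primorial:
  "n_prime n (x mod primorial n) \<longleftrightarrow> n_prime n x"
  unfolding n_prime_def by (intro ball_cong refl) (simp add: nth_prime_dvd_primorial dvd_mod_iff)

theorem corollary2:
  fixes n :: nat and a :: int
  assumes "n \<ge> 1"
    and "\<And>i. 1 \<le> i \<Longrightarrow> i \<le> n \<Longrightarrow> \<not> [a = 0] (mod int (nth_prime i))"
  shows "int (card {x \<in> P n. n_prime n ((x - a) mod primorial n) \<and>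
                              n_prime n ((x + a) mod primorial n)})
           = (\<Prod>i=3..n. int (nth_prime i) - 2)"
proof -
  define p where "p i = int (nth_prime i)" for i
  have prime_p: "prime (p i)" for i
    by (simp add: p_def prime_nth_prime)
  have p_pos: "p i > 0" for i
    using prime_p prime_gt_0_int by blast
  have primorial_p: "primorial n = prod p {1..n}"
    by (simp only: primorial_def p_def[abs_def])
  have p_1: "p 1 = 2" and p_2: "p 2 = 3"
    by (simp_all only: p_def nth_prime_1 nth_prime_2 of_nat_numeral)
  have coprime_p: "coprime (p i) (p j)" if "i \<in> {1..n}" "j \<in> {1..n}" "i \<noteq> j" for i j
    using that prime_p nth_prime_inj by (intro primes_coprime) (auto simp: p_def)
  define R where "R i r \<longleftrightarrow> \<not> p i dvd r - a \<and> \<not> p i dvd r + a" for i r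
  \<comment> \<open>The condition at \<open>p i\<close> depends only on the residue of
    \<open>x\<close>, so it fits the product count.\<close>
  have R_mod: "R i (x mod p i) \<longleftrightarrow> \<not> p i dvd x - a \<and> \<not> p i dvd x + a" for i x
    by (simp only: R_def dvd_eq_mod_eq_0 mod_diff_left_eq mod_add_left_eq)
  have "{x \<in> P n. n_prime n ((x - a) mod primorial n) \<and> n_prime n ((x + a) mod primorial n)}
      = {x \<in> {0..<prod p {1..n}}. \<forall>i\<in>{1..n}. R i (x mod p i)}"
    unfolding n_prime_mod_primorial unfolding R_mod P_def primorial_p
    by (simp only: n_prime_def p_def ball_conj_distrib mem_Collect_eq atLeastLessThan_iff conj_assoc)
  then have "int (card {x \<in> P n. n_prime n ((x - a) mod primorial n) \<and>
                                  n_prime n ((x + a) mod primorial n)})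
      = (\<Prod>i\<in>{1..n}. int (card {r \<in> {0..<p i}. R i r}))"
    using card_residue_conditions_prod[of "{1..n}" p R] p_pos coprime_p by simp
  also have "\<dots> = (\<Prod>i\<in>{1..n}. if i = 1 then 1 else p i - 2)"
  proof (rule prod.cong[OF refl])
    fix i assume i: "i \<in> {1..n}"
    \<comment> \<open>Here the hypothesis on \<open>a\<close> enters: since \<open>p i\<close> is
      prime and does not divide \<open>a\<close>, it divides \<open>2 * a\<close> only if it divides
      2, that is, if \<open>i = 1\<close>. The local count is then 2 - 1 = 1.\<close>
    have not_dvd_a: "\<not> p i dvd a"
      using assms(2) i by (simp add: p_def cong_0_iff)
    have "p i dvd 2 \<longleftrightarrow> p i = p 1"
      using primes_dvd_imp_eq[of "p i" 2] prime_p[of i] p_1 by auto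
    also have "\<dots> \<longleftrightarrow> i = 1"
      using nth_prime_inj[of i 1] i by (auto simp: p_def)
    finally have "p i dvd 2 * a \<longleftrightarrow> i = 1"
      using not_dvd_a prime_dvd_mult_iff[OF prime_p[of i]] by blast
    then show "int (card {r \<in> {0..<p i}. R i r}) = (if i = 1 then 1 else p i - 2)"
      using card_residues_avoiding[OF p_pos[of i], of a] p_1 by (auto simp: R_def)
  qed
  also have "\<dots> = (\<Prod>i=3..n. p i - 2)"
  \<comment> \<open>Only the indices 1 and 2 are dropped, as far as they occur; the factor at 2 is 3
    - 2 = 1. For \<open>n < 3\<close> the remaining product is empty.\<close>
  proof (rule prod.mono_neutral_cong_right)
    show "\<forall>i\<in>{1..n} - {3..n}. (if i = 1 then 1 else p i - 2) = 1"
    proof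
      fix i assume "i \<in> {1..n} - {3..n}"
      then have "i = 1 \<or> i = 2" by auto
      then show "(if i = 1 then 1 else p i - 2) = 1"
        using p_2 by auto
    qed
  qed auto
  finally show ?thesis
    by (simp add: p_def)
qed

end
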